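(* Let $X\subset\mathbb{R}^2$ be a smooth curve and let $P_1,P_2,P_3$ be three distinct points on $X$ which satisfy the corank 1 condition. Then there exist positive balancing charges for $P_1,P_2,P_3$ (that is, balancing charges $q=(q_1,q_2,q_3)$ with $q_1,q_2,q_3>0$) if and only if the three normals to $X$ at the points $P_1,P_2,P_3$ enter the interior of the triangle $\triangle P_1P_2P_3$.
   Context: Let $p_i=\overrightarrow{OP_i}$ be the position vector of $P_i$, $d_{ij}=\|p_i-p_j\|$, and let $T_i$ be the (unit) tangent vector to $X$ at $P_i$. Put $a_{ij}=\frac{\langle p_i-p_j,T_i\rangle}{d_{ij}^3}$ for $i\neq j$ and $a_{ii}=0$. The points satisfy the corank 1 condition if $\operatorname{rank}(a_{ij})\le 2$. Charges $q=(q_1,q_2,q_3)\neq(0,0,0)$ are balancing for $P_1,P_2,P_3$ (the points are in $E_q$-equilibrium for the Coulomb potential $E_q=-\sum_{i<j}\frac{q_iq_j}{d_{ij}}$) if at every $P_i$ the resultant of the Coulomb forces $F_{ji}=\frac{q_iq_j}{d_{ij}^3}(p_i-p_j)$ is orthogonal to $T_i$, i.e. $\sum_{j\ne i}\frac{q_iq_j}{d_{ij}^3}\langle p_i-p_j,T_i\rangle=0$ for $i=1,2,3$. The normal to $X$ at $P_i$ is the line through $P_i$ orthogonal to $T_i$; it enters the interior of the triangle if it meets the interior of $\triangle P_1P_2P_3$. *)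

theory Defs
  imports "HOL-Analysis.Analysis"
begin

definition smooth_path_on :: "real set \<Rightarrow> (real \<Rightarrow> real ^ 2) \<Rightarrow> bool" where
  "smooth_path_on I g \<longleftrightarrow>
     (\<exists>D :: nat \<Rightarrow> real \<Rightarrow> real ^ 2.
        D 0 = g \<and> (\<forall>k. \<forall>t\<in>I. (D k has_vector_derivative D (Suc k) t) (at t)))"

(* One-dimensional embedded C-infinity submanifolds of the plane, described by regular local
   parametrizations; connectedness is not required. *)
definition smooth_curve :: "(real ^ 2) set \<Rightarrow> bool" where
  "smooth_curve X \<longleftrightarrow>
     (\<forall>p\<in>X. \<exists>U a b g h. open U \<and> p \<in> U \<and> a < b \<and>
        smooth_path_on {a<..<b} g \<and>
        (\<forall>t\<in>{a<..<b}. vector_derivative g (at t) \<noteq> 0) \<and>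
        homeomorphism {a<..<b} (X \<inter> U) g h)"

definition unit_tangent :: "(real ^ 2) set \<Rightarrow> real ^ 2 \<Rightarrow> real ^ 2 \<Rightarrow> bool" where
  "unit_tangent X p v \<longleftrightarrow> norm v = 1 \<and>
     (\<exists>e>0. \<exists>g. smooth_path_on {-e<..<e} g \<and> g ` {-e<..<e} \<subseteq> X \<and>
        g 0 = p \<and> (g has_vector_derivative v) (at 0))"

definition coulomb_matrix ::
  "('n::finite \<Rightarrow> real ^ 2) \<Rightarrow> ('n \<Rightarrow> real ^ 2) \<Rightarrow> real ^ 'n ^ 'n" where
  "coulomb_matrix P T =
     (\<chi> i j. if i = j then 0 else ((P i - P j) \<bullet> T i) / dist (P i) (P j) ^ 3)"

definition corank1 :: "(3 \<Rightarrow> real ^ 2) \<Rightarrow> (3 \<Rightarrow> real ^ 2) \<Rightarrow> bool" where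
  "corank1 P T \<longleftrightarrow> rank (coulomb_matrix P T) \<le> 2"

(* The force exerted by the charge at P j on the charge at P i. *)
definition coulomb_force ::
  "('n::finite \<Rightarrow> real ^ 2) \<Rightarrow> real ^ 'n \<Rightarrow> 'n \<Rightarrow> 'n \<Rightarrow> real ^ 2" where
  "coulomb_force P q j i = (q $ i * q $ j / dist (P i) (P j) ^ 3) *\<^sub>R (P i - P j)"

definition balancing ::
  "('n::finite \<Rightarrow> real ^ 2) \<Rightarrow> ('n \<Rightarrow> real ^ 2) \<Rightarrow> real ^ 'n \<Rightarrow> bool" where
  "balancing P T q \<longleftrightarrow> q \<noteq> 0 \<and>
     (\<forall>i. orthogonal (\<Sum>j\<in>UNIV - {i}. coulomb_force P q j i) (T i))"

definition normal_line :: "real ^ 2 \<Rightarrow> real ^ 2 \<Rightarrow> (real ^ 2) set" where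
  "normal_line p v = {x. orthogonal (x - p) v}"

(* The relative interior is the ordinary interior as soon as the triangle is nondegenerate (lemma
   below). For collinear points the ordinary interior is empty, although positive balancing
   charges may exist: take three points on a line that is normal to
   X at each of them. *)
definition triangle_interior :: "(3 \<Rightarrow> real ^ 2) \<Rightarrow> (real ^ 2) set" where
  "triangle_interior P = rel_interior (convex hull {P 1, P 2, P 3})"

lemma triangle_interior_eq_interior:
  assumes "\<not> collinear {P 1, P 2, P 3}"
  shows "triangle_interior P = interior (convex hull {P 1, P 2, P 3})"
proof -
  have dim2: "DIM(real ^ 2) = 2" by simp
  have "(1/3) *\<^sub>R P 1 + (1/3) *\<^sub>R P 2 + (1/3) *\<^sub>R P 3 \<in> interior (convex hull {P 1, P 2, P 3})"
    unfolding interior_convex_hull_3_minimal [OF assms dim2]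
    by (rule CollectI, intro exI [of _ "1/3"] conjI) simp_all
  then show ?thesis
    unfolding triangle_interior_def by (intro rel_interior_nonempty_interior) blast
qed

end

theory Submission
  imports Defs
begin

text \<open>
  Write \<open>A\<close> for the Coulomb matrix. Both conditions concern the signs in its rows: the normal at
  \<open>P i\<close> enters the open triangle iff the two off-diagonal entries of row \<open>i\<close> have opposite signs or
  both vanish, and positive charges annihilated by \<open>A\<close> force the same. Conversely, such
  a row prescribes one positive ratio between the two other charges, or leaves it free if it
  vanishes; \<open>det A = 0\<close> says that the three ratios are compatible when no row vanishes.
\<close>

text \<open>Each vertex is viewed as a convex singleton, which is its own relative interior. Hence
  strictly positive barycentric coordinates describe the triangle even when the vertices are
  collinear.\<close>

lemma triangle_interior_eq:
  "triangle_interior P = {\<Sum>i\<in>UNIV. c i *\<^sub>R P i |c. (\<forall>i. c i > 0) \<and> sum c UNIV = 1}"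
proof -
  have union: "{P 1, P 2, P 3} = (\<Union>i. {P i})"
    by (auto simp: UNIV_3)
  show ?thesis
    unfolding triangle_interior_def union
    by (subst rel_interior_convex_hull_union) auto
qed

lemma UNIV_3_eq:
  assumes "i \<noteq> j" "i \<noteq> k" "j \<noteq> (k :: 3)"
  shows "UNIV = {i, j, k}"
  using assms by (intro card_subset_eq [symmetric]) auto

lemma coulomb_matrix_offdiag:
  "i \<noteq> j \<Longrightarrow> coulomb_matrix P T $ i $ j = ((P i - P j) \<bullet> T i) / dist (P i) (P j) ^ 3"
  by (simp add: coulomb_matrix_def)

text \<open>Both forces on \<open>P i\<close> carry the factor \<open>q $ i\<close>; cancelling it
  turns the quadratic equilibrium condition into row \<open>i\<close> of a linear system.\<close>

lemma orthogonal_coulomb_force_iff: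
  assumes "i \<noteq> j" "i \<noteq> k" "j \<noteq> (k :: 3)" "q $ i \<noteq> 0"
  shows "orthogonal (\<Sum>j\<in>UNIV - {i}. coulomb_force P q j i) (T i) \<longleftrightarrow>
    coulomb_matrix P T $ i $ j * q $ j + coulomb_matrix P T $ i $ k * q $ k = 0"
proof -
  have "UNIV - {i} = {j, k}"
    using UNIV_3_eq [OF assms(1-3)] assms by auto
  then have "(\<Sum>j\<in>UNIV - {i}. coulomb_force P q j i) \<bullet> T i =
      q $ i * (coulomb_matrix P T $ i $ j * q $ j + coulomb_matrix P T $ i $ k * q $ k)"
    using assms
    by (simp add: coulomb_force_def coulomb_matrix_offdiag inner_add_left diff_divide_distrib algebra_simps)
  then show ?thesis
    using assms by (simp add: orthogonal_def)
qed

text \<open>Relative to \<open>P i\<close>, a point with barycentric coordinates \<open>c\<close>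
  has tangential component \<open>- (c j * a + c k * b)\<close>. It can vanish for positive weights
  iff \<open>b\<close> is a negative multiple of \<open>a\<close>; the cubed distances only rescale
  the multiple.\<close>

lemma normal_line_meets_interior_iff:
  assumes "i \<noteq> j" "i \<noteq> k" "j \<noteq> (k :: 3)" "inj P"
  shows "normal_line (P i) (T i) \<inter> triangle_interior P \<noteq> {} \<longleftrightarrow>
    (\<exists>r>0. coulomb_matrix P T $ i $ k = - r * coulomb_matrix P T $ i $ j)"
proof -
  define a where "a = (P i - P j) \<bullet> T i"
  define b where "b = (P i - P k) \<bullet> T i"
  define u where "u = dist (P i) (P j) ^ 3"
  define v where "v = dist (P i) (P k) ^ 3"
  have pos: "u > 0" "v > 0"
    using assms unfolding u_def v_def by (auto simp: inj_eq)
  have A: "coulomb_matrix P T $ i $ j = a / u" "coulomb_matrix P T $ i $ k = b / v"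
    using assms by (simp_all add: coulomb_matrix_offdiag a_def b_def u_def v_def)
  have sum3: "sum f UNIV = f i + f j + f k" for f :: "3 \<Rightarrow> 'z::comm_monoid_add"
    using assms by (simp add: UNIV_3_eq [OF assms(1-3)] add.assoc)
  have offset: "(\<Sum>l\<in>UNIV. c l *\<^sub>R P l) - P i = - (c j *\<^sub>R (P i - P j) + c k *\<^sub>R (P i - P k))"
    if "sum c UNIV = 1" for c
  proof -
    have ci: "c i = 1 - c j - c k"
      using that by (simp add: sum3)
    show ?thesis
      unfolding sum3 ci by (simp add: algebra_simps)
  qed
  have inner: "((\<Sum>l\<in>UNIV. c l *\<^sub>R P l) - P i) \<bullet> T i = - (c j * a + c k * b)"
    if "sum c UNIV = 1" for c
    by (simp only: offset [OF that]) (simp add: inner_simps a_def b_def algebra_simps)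
  have "normal_line (P i) (T i) \<inter> triangle_interior P \<noteq> {} \<longleftrightarrow>
      (\<exists>c. (\<forall>l. c l > 0) \<and> sum c UNIV = 1 \<and> ((\<Sum>l\<in>UNIV. c l *\<^sub>R P l) - P i) \<bullet> T i = 0)"
    unfolding normal_line_def triangle_interior_eq orthogonal_def by blast
  also have "\<dots> \<longleftrightarrow> (\<exists>c. (\<forall>l. c l > 0) \<and> sum c UNIV = 1 \<and> c j * a + c k * b = 0)"
    by (simp only: inner neg_equal_0_iff_equal cong: conj_cong)
  also have "\<dots> \<longleftrightarrow> (\<exists>r>0. b / v = - r * (a / u))"
  proof safe
    fix c :: "3 \<Rightarrow> real"
    assume c: "\<forall>l. c l > 0" "c j * a + c k * b = 0"
    then have "b = - (c j / c k) * a"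
      by (simp add: field_simps less_imp_neq [THEN not_sym])
    then show "\<exists>r>0. b / v = - r * (a / u)"
      using c pos by (intro exI [of _ "c j / c k * (u / v)"]) simp
  next
    fix r :: real
    assume r: "r > 0" "b / v = - r * (a / u)"
    \<comment> \<open>This undoes the rescaling by the cubed distances: \<open>s\<close> is the
      required ratio of \<open>c j\<close> to \<open>c k\<close>.\<close>
    define s where "s = r * v / u"
    have s: "s > 0" "b = - s * a"
      using r pos by (simp_all add: s_def field_simps)
    \<comment> \<open>Only the ratio of \<open>c j\<close> to \<open>c k\<close> matters, so the
      weight at \<open>i\<close> is chosen freely; \<open>s + 2\<close> normalises the sum.\<close>
    define c where "c = (\<lambda>l. (if l = j then s else 1) / (s + 2))"
    have "sum c UNIV = 1"
      using s assms by (simp add: sum3 c_def field_simps)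
    then show "\<exists>c. (\<forall>l. c l > 0) \<and> sum c UNIV = 1 \<and> c j * a + c k * b = 0"
      using s assms by (intro exI [of _ c]) (auto simp: c_def)
  qed
  finally show ?thesis
    by (simp add: A)
qed

text \<open>The assumption says that the matrix with rows \<open>(0, a, b)\<close>,
  \<open>(c, 0, d)\<close>, \<open>(e, f, 0)\<close> has determinant zero.\<close>

lemma positive_kernel_iff:
  fixes a b c d e f :: real
  assumes "a * d * e + b * c * f = 0"
  shows "(\<exists>x>0. \<exists>y>0. \<exists>z>0. a * y + b * z = 0 \<and> c * x + d * z = 0 \<and> e * x + f * y = 0) \<longleftrightarrow>
    (\<exists>r>0. b = - r * a) \<and> (\<exists>s>0. d = - s * c) \<and> (\<exists>t>0. f = - t * e)"
proof safe
  fix x y z :: real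
  assume *: "x > 0" "y > 0" "z > 0"
    "a * y + b * z = 0" "c * x + d * z = 0" "e * x + f * y = 0"
  show "\<exists>r>0. b = - r * a"
    using * by (intro exI [of _ "y / z"]) (auto simp: field_simps)
  show "\<exists>s>0. d = - s * c"
    using * by (intro exI [of _ "x / z"]) (auto simp: field_simps)
  show "\<exists>t>0. f = - t * e"
    using * by (intro exI [of _ "x / y"]) (auto simp: field_simps)
next
  fix r s t :: real
  assume pos: "r > 0" "s > 0" "t > 0" and eqs: "b = - r * a" "d = - s * c" "f = - t * e"
  \<comment> \<open>Nonvanishing rows demand \<open>y = r * z\<close>, \<open>x = s * z\<close> and
    \<open>x = t * y\<close>, which are compatible exactly when \<open>s = r * t\<close>.\<close>
  have "a * c * e * (r * t - s) = 0"
    using assms by (simp add: eqs algebra_simps)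
  then consider "a = 0" | "c = 0" | "e = 0 \<or> s = r * t"
    by auto
  then show "\<exists>x>0. \<exists>y>0. \<exists>z>0. a * y + - r * a * z = 0 \<and> c * x + - s * c * z = 0 \<and>
      e * x + - t * e * y = 0"
  \<comment> \<open>Normalise \<open>z = 1\<close>. In each case two rows determine \<open>x\<close>
    and \<open>y\<close>, and the remaining row vanishes or follows from
    \<open>s = r * t\<close>.\<close>
  proof cases
    case 1
    then show ?thesis
      using pos by (intro exI [of _ s] exI [of _ "s / t"] exI [of _ 1] conjI) auto
  next
    case 2
    then show ?thesis
      using pos by (intro exI [of _ "r * t"] exI [of _ r] exI [of _ 1] conjI) auto
  next
    case 3
    then show ?thesis
      using pos by (intro exI [of _ s] exI [of _ r] exI [of _ 1] conjI) auto
  qed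
qed

theorem proposition2:
  fixes X :: "(real ^ 2) set" and P T :: "3 \<Rightarrow> real ^ 2"
  assumes "smooth_curve X"
    and "inj P" and "\<And>i. P i \<in> X"
    and "\<And>i. unit_tangent X (P i) (T i)"
    and "corank1 P T"
  shows "(\<exists>q :: real ^ 3. balancing P T q \<and> (\<forall>i. q $ i > 0)) \<longleftrightarrow>
         (\<forall>i. normal_line (P i) (T i) \<inter> triangle_interior P \<noteq> {})"
proof -
  let ?A = "coulomb_matrix P T"
  have diag: "?A $ i $ i = 0" for i
    by (simp add: coulomb_matrix_def)
  have "det ?A = 0"
    using assms(5) by (simp add: corank1_def det_eq_0_rank)
  \<comment> \<open>With a zero diagonal, only the two 3-cycles contribute to the
    determinant.\<close>
  then have det: "?A $ 1 $ 2 * ?A $ 2 $ 3 * ?A $ 3 $ 1 + ?A $ 1 $ 3 * ?A $ 2 $ 1 * ?A $ 3 $ 2 = 0"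
    by (simp add: det_3 diag)
  have "balancing P T q \<longleftrightarrow>
      ?A $ 1 $ 2 * q $ 2 + ?A $ 1 $ 3 * q $ 3 = 0 \<and>
      ?A $ 2 $ 1 * q $ 1 + ?A $ 2 $ 3 * q $ 3 = 0 \<and>
      ?A $ 3 $ 1 * q $ 1 + ?A $ 3 $ 2 * q $ 2 = 0" if "\<forall>i. q $ i > 0" for q
  proof -
    have nz: "q $ i \<noteq> 0" for i
      using that by (metis less_irrefl)
    then have "q \<noteq> 0"
      by auto
    then show ?thesis
      unfolding balancing_def forall_3
      using orthogonal_coulomb_force_iff [OF _ _ _ nz, of 1 2 3 P T]
        orthogonal_coulomb_force_iff [OF _ _ _ nz, of 2 1 3 P T]
        orthogonal_coulomb_force_iff [OF _ _ _ nz, of 3 1 2 P T]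
      by simp
  qed
  then have "(\<exists>q :: real ^ 3. balancing P T q \<and> (\<forall>i. q $ i > 0)) \<longleftrightarrow>
      (\<exists>q :: real ^ 3. (\<forall>i. q $ i > 0) \<and>
        ?A $ 1 $ 2 * q $ 2 + ?A $ 1 $ 3 * q $ 3 = 0 \<and>
        ?A $ 2 $ 1 * q $ 1 + ?A $ 2 $ 3 * q $ 3 = 0 \<and>
        ?A $ 3 $ 1 * q $ 1 + ?A $ 3 $ 2 * q $ 2 = 0)"
    by blast
  also have "\<dots> \<longleftrightarrow> (\<exists>x>0. \<exists>y>0. \<exists>z>0.
      ?A $ 1 $ 2 * y + ?A $ 1 $ 3 * z = 0 \<and> ?A $ 2 $ 1 * x + ?A $ 2 $ 3 * z = 0 \<and>
      ?A $ 3 $ 1 * x + ?A $ 3 $ 2 * y = 0)" (is "?L \<longleftrightarrow> ?R")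
  proof
    assume ?L
    then show ?R by blast
  next
    assume ?R
    then obtain x y z where "x > 0" "y > 0" "z > 0"
      "?A $ 1 $ 2 * y + ?A $ 1 $ 3 * z = 0" "?A $ 2 $ 1 * x + ?A $ 2 $ 3 * z = 0"
      "?A $ 3 $ 1 * x + ?A $ 3 $ 2 * y = 0"
      by blast
    then show ?L
      by (intro exI [of _ "vector [x, y, z]"]) (simp add: forall_3)
  qed
  \<comment> \<open>The index triples below list the other two vertices in increasing order, so that
    the multiples \<open>r\<close>, \<open>s\<close>, \<open>t\<close> match row by row.\<close>
  also have "\<dots> \<longleftrightarrow> (\<forall>i. normal_line (P i) (T i) \<inter> triangle_interior P \<noteq> {})"
    unfolding positive_kernel_iff [OF det] forall_3
    using normal_line_meets_interior_iff [OF _ _ _ \<open>inj P\<close>, of 1 2 3 T]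
      normal_line_meets_interior_iff [OF _ _ _ \<open>inj P\<close>, of 2 1 3 T]
      normal_line_meets_interior_iff [OF _ _ _ \<open>inj P\<close>, of 3 1 2 T]
    by simp
  finally show ?thesis .
qed

end
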